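(* For an injective map $h : Q \to P$ of fine monoids, the following are equivalent: (1) $h$ is dense. (2) $h$ is finite. (3) $h$ is finite and $\operatorname{Spec} h$ is a homeomorphism. (4) $h$ is quasi-finite and $\operatorname{Spec} h$ is surjective. (5) $h$ is quasi-finite and local.
   Context: Monoids are commutative, written additively, with $0$. $P^*$ is the group of units of $P$, and $P^{\rm gp}$ its groupification. $P$ is fine if it is finitely generated and $P \to P^{\rm gp}$ is injective. A face of $P$ is a submonoid $F$ such that $p+p' \in F$ implies $p,p' \in F$; $F^{-1}P$ denotes the localization of $P$ at $F$. The topological space $\operatorname{Spec} P$ is the set of faces of $P$, with basis of open sets $U_p = \{F : p \in F\}$ ($p \in P$); $\operatorname{Spec} h : \operatorname{Spec} P \to \operatorname{Spec} Q$ is the map $F \mapsto h^{-1}(F)$. A monoid map $h : Q \to P$ is: local if $h^{-1}(P^* ) = Q^*$; dense if for every $p \in P$ there are a positive integer $n$ and $q \in Q$ with $np = h(q)$; finite if there is a finite subset $S \subseteq P$ such that every element of $P$ is of the form $h(q)+s$ with $q \in Q$, $s \in S$. A map $h : Q \to P$ of fine monoids is quasi-finite if the map of schemes $\operatorname{Spec} \mathbb{Z}[P] \to \operatorname{Spec} \mathbb{Z}[Q]$ induced on monoid algebras is quasi-finite (of finite type with finite fibers); equivalently, for every face $F$ of $P$, the group homomorphism $(h^{-1}(F)^{-1}Q)^* \to (F^{-1}P)^*$ has finite cokernel. *)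

theory Defs
  imports
    "HOL-Analysis.Abstract_Topology"
    "HOL-Algebra.Generated_Rings"
    "HOL-Algebra.Algebraic_Closure_Type"
    "HOL-Library.Poly_Mapping"
begin

text \<open>
  Commutative monoids are the types of class \<^class>\<open>comm_monoid_add\<close>.
\<close>

section \<open>Monoids, groupification, faces\<close>

definition submonoid_add :: "'a::comm_monoid_add set \<Rightarrow> bool" where
  "submonoid_add M \<longleftrightarrow> 0 \<in> M \<and> (\<forall>x\<in>M. \<forall>y\<in>M. x + y \<in> M)"

definition monoid_map :: "('a::comm_monoid_add \<Rightarrow> 'b::comm_monoid_add) \<Rightarrow> bool" where
  "monoid_map h \<longleftrightarrow> h 0 = 0 \<and> (\<forall>x y. h (x + y) = h x + h y)"

definition units_add :: "'a::comm_monoid_add set" where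
  "units_add = {p. \<exists>p'. p + p' = 0}"

text \<open>The pair \<open>(a, b)\<close> represents the formal difference \<open>a - b\<close>.\<close>

definition gp_rel :: "'a::comm_monoid_add \<times> 'a \<Rightarrow> 'a \<times> 'a \<Rightarrow> bool" where
  "gp_rel x y \<longleftrightarrow> (\<exists>s. fst x + snd y + s = fst y + snd x + s)"

lemma equivp_gp_rel: "equivp (gp_rel :: 'a::comm_monoid_add \<times> 'a \<Rightarrow> _)"
proof (rule equivpI)
  show "reflp (gp_rel :: 'a \<times> 'a \<Rightarrow> _)"
    by (auto simp: reflp_def gp_rel_def)
  show "symp (gp_rel :: 'a \<times> 'a \<Rightarrow> _)"
    by (auto simp: symp_def gp_rel_def intro: sym)
  show "transp (gp_rel :: 'a \<times> 'a \<Rightarrow> _)"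
  proof (rule transpI)
    fix x y z :: "'a \<times> 'a"
    assume "gp_rel x y" "gp_rel y z"
    then obtain s t where s: "fst x + snd y + s = fst y + snd x + s"
      and t: "fst y + snd z + t = fst z + snd y + t"
      by (auto simp: gp_rel_def)
    let ?u = "fst y + snd y + s + t"
    have "fst x + snd z + ?u = (fst x + snd y + s) + (fst y + snd z + t)"
      by (simp add: ac_simps)
    also have "\<dots> = fst z + snd x + ?u"
      unfolding s t by (simp add: ac_simps)
    finally show "gp_rel x z"
      unfolding gp_rel_def by blast
  qed
qed

quotient_type (overloaded) 'a gp = "'a::comm_monoid_add \<times> 'a" / gp_rel
  by (rule equivp_gp_rel)

instantiation gp :: (comm_monoid_add) ab_group_add
begin

lift_definition zero_gp :: "'a gp" is "(0, 0)" .

lift_definition plus_gp :: "'a gp \<Rightarrow> 'a gp \<Rightarrow> 'a gp"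
  is "\<lambda>(a, b) (c, d). (a + c, b + d)"
proof -
  fix x x' y y' :: "'a \<times> 'a"
  assume "gp_rel x x'" "gp_rel y y'"
  then obtain s t where s: "fst x + snd x' + s = fst x' + snd x + s"
    and t: "fst y + snd y' + t = fst y' + snd y + t"
    by (auto simp: gp_rel_def)
  have "(fst x + fst y) + (snd x' + snd y') + (s + t)
      = (fst x + snd x' + s) + (fst y + snd y' + t)"
    by (simp add: ac_simps)
  also have "\<dots> = (fst x' + fst y') + (snd x + snd y) + (s + t)"
    unfolding s t by (simp add: ac_simps)
  finally show "gp_rel ((case x of (a, b) \<Rightarrow> \<lambda>(c, d). (a + c, b + d)) y)
      ((case x' of (a, b) \<Rightarrow> \<lambda>(c, d). (a + c, b + d)) y')"
    unfolding gp_rel_def by (auto simp: case_prod_beta)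
qed

lift_definition uminus_gp :: "'a gp \<Rightarrow> 'a gp" is "\<lambda>(a, b). (b, a)"
  by (auto simp: gp_rel_def case_prod_beta add.commute intro: sym)

definition minus_gp :: "'a gp \<Rightarrow> 'a gp \<Rightarrow> 'a gp" where
  "minus_gp x y = x + - y"

instance
proof
  fix x y z :: "'a gp"
  show "x + y + z = x + (y + z)"
    by transfer (auto simp: gp_rel_def ac_simps)
  show "x + y = y + x"
    by transfer (auto simp: gp_rel_def ac_simps)
  show "0 + x = x"
    by transfer (auto simp: gp_rel_def ac_simps)
  show "- x + x = 0"
    by transfer (auto simp: gp_rel_def ac_simps)
  show "x - y = x + - y"
    by (rule minus_gp_def)
qed

end

lift_definition to_gp :: "'a::comm_monoid_add \<Rightarrow> 'a gp" is "\<lambda>p. (p, 0)" .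

definition fine_monoid :: "'a::comm_monoid_add itself \<Rightarrow> bool" where
  "fine_monoid _ \<longleftrightarrow>
     (\<exists>S::'a set. finite S \<and> submonoid_add hull S = UNIV) \<and> inj (to_gp :: 'a \<Rightarrow> 'a gp)"

definition face :: "'a::comm_monoid_add set \<Rightarrow> bool" where
  "face F \<longleftrightarrow> submonoid_add F \<and> (\<forall>p p'. p + p' \<in> F \<longrightarrow> p \<in> F \<and> p' \<in> F)"


section \<open>The spectrum of a monoid\<close>

definition basic_open :: "'a::comm_monoid_add \<Rightarrow> 'a set set" where
  "basic_open p = {F. face F \<and> p \<in> F}"

definition Spec :: "'a::comm_monoid_add set topology" where
  "Spec = topology_generated_by (range basic_open)"

definition Spec_map ::
    "('a::comm_monoid_add \<Rightarrow> 'b::comm_monoid_add) \<Rightarrow> 'b set \<Rightarrow> 'a set" where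
  "Spec_map h F = h -` F"

lemma topspace_Spec: "topspace Spec = {F. face F}"
  by (auto simp: Spec_def basic_open_def face_def submonoid_add_def)

lemma basic_open_Int: "basic_open p \<inter> basic_open q = basic_open (p + q)"
  by (auto simp: basic_open_def face_def submonoid_add_def)

text \<open>The sets \<^const>\<open>basic_open\<close> are a basis of \<^const>\<open>Spec\<close>, not merely a subbasis.\<close>

lemma openin_Spec: "openin Spec = arbitrary union_of (\<lambda>U. U \<in> range basic_open)"
proof -
  have "\<exists>V. V \<in> range basic_open \<and> x \<in> V \<and> V \<subseteq> U"
    if "generate_topology_on (range basic_open) U" "x \<in> U" for U and x :: "'a set"
    using that
  proof (induction arbitrary: x)
    case (Int a b)
    then obtain p q where "x \<in> basic_open p" "basic_open p \<subseteq> a"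
        "x \<in> basic_open q" "basic_open q \<subseteq> b"
      by (metis IntE imageE)
    then show ?case
      using basic_open_Int[of p q] by blast
  next
    case (UN K)
    then show ?case by (meson Sup_upper UnionE order_trans)
  qed auto
  then show ?thesis
    unfolding openin_topology_base_unique Spec_def
    by (auto simp: openin_topology_generated_by_iff intro: generate_topology_on.Basis)
qed


section \<open>Properties of monoid maps\<close>

definition local_map :: "('a::comm_monoid_add \<Rightarrow> 'b::comm_monoid_add) \<Rightarrow> bool" where
  "local_map h \<longleftrightarrow> h -` units_add = units_add"

text \<open>The sum \<open>\<Sum>i<n. p\<close> is the multiple \<open>n p\<close>.\<close>

definition dense_map :: "('a::comm_monoid_add \<Rightarrow> 'b::comm_monoid_add) \<Rightarrow> bool" where
  "dense_map h \<longleftrightarrow> (\<forall>p. \<exists>n::nat. n > 0 \<and> (\<exists>q. (\<Sum>i<n. p) = h q))"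

definition finite_map :: "('a::comm_monoid_add \<Rightarrow> 'b::comm_monoid_add) \<Rightarrow> bool" where
  "finite_map h \<longleftrightarrow> (\<exists>S. finite S \<and> (\<forall>p. \<exists>q. \<exists>s\<in>S. p = h q + s))"


section \<open>Quasi-finiteness\<close>

definition prime_spectrum :: "'r::comm_ring_1 set set" where
  "prime_spectrum = {I. primeideal I ring_of_type_algebra}"

definition finite_type_ring_map :: "('r::comm_ring_1 \<Rightarrow> 's::comm_ring_1) \<Rightarrow> bool" where
  "finite_type_ring_map \<phi> \<longleftrightarrow>
     (\<exists>S. finite S \<and> generate_ring ring_of_type_algebra (range \<phi> \<union> S) = UNIV)"

text \<open>
  Quasi-finiteness of the morphism of affine schemes given by \<open>\<phi>\<close>: finite type, and every
  point \<open>\<pp>\<close> of the target has only finitely many preimages.  (The underlying space of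
  the scheme-theoretic fibre over \<open>\<pp>\<close> is this set of preimages.)
\<close>

definition quasi_finite_ring_map :: "('r::comm_ring_1 \<Rightarrow> 's::comm_ring_1) \<Rightarrow> bool" where
  "quasi_finite_ring_map \<phi> \<longleftrightarrow> finite_type_ring_map \<phi> \<and>
     (\<forall>\<pp>\<in>prime_spectrum. finite {\<qq>\<in>prime_spectrum. \<phi> -` \<qq> = \<pp>})"

text \<open>
  The monoid algebra over the integers is \<^typ>\<open>'a \<Rightarrow>\<^sub>0 int\<close> with the convolution product;
  the following is the ring map sending the basis element at \<open>q\<close> to the one at \<open>h q\<close>.
\<close>

definition monoid_algebra_map ::
    "('a::comm_monoid_add \<Rightarrow> 'b::comm_monoid_add) \<Rightarrow> ('a \<Rightarrow>\<^sub>0 int) \<Rightarrow> ('b \<Rightarrow>\<^sub>0 int)" where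
  "monoid_algebra_map h = frag_extend (\<lambda>q. Poly_Mapping.single (h q) 1)"

definition quasi_finite_map :: "('a::comm_monoid_add \<Rightarrow> 'b::comm_monoid_add) \<Rightarrow> bool" where
  "quasi_finite_map h \<longleftrightarrow> quasi_finite_ring_map (monoid_algebra_map h)"

end

theory Submission
  imports Defs
begin

text \<open>
  If \<open>P = h(Q) + S\<close> with \<open>S\<close> finite, then translation by \<open>p\<close> induces a self-map of \<open>S\<close> modulo
  \<open>h(Q)\<close>, and a cycle of this dynamics gives \<open>n p \<in> h(Q)\<close> by cancellation; so finite maps are
  dense, and the converse is clear.  For dense \<open>h\<close>, faces of \<open>P\<close> and \<open>Q\<close> determine each other
  through multiples.  A finite \<open>h\<close> makes \<open>\<int>[P]\<close> a finite \<open>\<int>[Q]\<close>-module, and a module with \<open>N\<close>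
  generators has at most \<open>N\<close> primes over a given one.

  Conversely let \<open>h\<close> be quasi-finite and local.  For every face \<open>G\<close> of \<open>P\<close> and \<open>p \<in> G\<close>, some
  positive multiple of \<open>p\<close> is a difference of elements of \<open>h(h\<^sup>-\<^sup>1(G))\<close>: otherwise there is an additive
  \<open>\<psi> : P \<rightarrow> \<real>\<close> which vanishes on \<open>h(h\<^sup>-\<^sup>1(G))\<close> and has \<open>\<psi>(p) = 1\<close>, and the characters \<open>k\<^sup>\<psi>\<close> on \<open>G\<close>,
  extended by zero, have infinitely many kernels over one prime of \<open>\<int>[Q]\<close>.  Then induct on
  faces: if \<open>G\<close> contains no non-unit of \<open>h(Q)\<close> this already shows density on \<open>G\<close>; otherwise a
  non-unit of \<open>h(Q)\<close> in \<open>G\<close> allows one to eliminate all generators of \<open>G\<close> that do not have a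
  multiple in \<open>h(Q)\<close>.
\<close>

section \<open>Multiples, submonoids and faces\<close>

definition nsmul :: "nat \<Rightarrow> 'a::comm_monoid_add \<Rightarrow> 'a" where
  "nsmul n x = (\<Sum>i<n. x)"

lemma nsmul_0 [simp]: "nsmul 0 x = 0"
  and nsmul_Suc: "nsmul (Suc n) x = x + nsmul n x"
  and nsmul_one [simp]: "nsmul (Suc 0) x = x"
  by (simp_all add: nsmul_def add.commute)

lemma nsmul_add_left: "nsmul (m + n) x = nsmul m x + nsmul n x"
  by (induction m) (auto simp: nsmul_Suc add_ac)

lemma nsmul_add_right: "nsmul n (x + y) = nsmul n x + nsmul n y"
  by (simp add: nsmul_def sum.distrib)

lemma nsmul_nsmul: "nsmul m (nsmul n x) = nsmul (m * n) x"
  by (induction m) (auto simp: nsmul_Suc nsmul_add_left)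

lemma monoid_map_nsmul:
  assumes "monoid_map h"
  shows "h (nsmul n x) = nsmul n (h x)"
  using assms by (induction n) (auto simp: monoid_map_def nsmul_Suc)

lemma dense_map_iff: "dense_map h \<longleftrightarrow> (\<forall>p. \<exists>n>0. nsmul n p \<in> range h)"
  by (simp add: dense_map_def nsmul_def image_iff)

lemma dense_mapE:
  assumes "dense_map h"
  obtains n q where "n > 0" "nsmul n p = h q"
  using assms unfolding dense_map_def nsmul_def by blast

lemma submonoid_addI:
  "0 \<in> M \<Longrightarrow> (\<And>x y. x \<in> M \<Longrightarrow> y \<in> M \<Longrightarrow> x + y \<in> M) \<Longrightarrow> submonoid_add M"
  by (simp add: submonoid_add_def)

lemma submonoid_zero: "submonoid_add M \<Longrightarrow> 0 \<in> M"
  and submonoid_add: "submonoid_add M \<Longrightarrow> x \<in> M \<Longrightarrow> y \<in> M \<Longrightarrow> x + y \<in> M"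
  by (simp_all add: submonoid_add_def)

lemma submonoid_nsmul: "submonoid_add M \<Longrightarrow> x \<in> M \<Longrightarrow> nsmul n x \<in> M"
  by (induction n) (auto simp: submonoid_add_def nsmul_Suc)

lemma submonoid_hull: "submonoid_add (submonoid_add hull S)"
  by (rule hull_in) (auto simp: submonoid_add_def)

lemma submonoid_range:
  assumes "monoid_map h"
  shows "submonoid_add (range h)"
proof -
  have h: "h 0 = 0" "h x + h y = h (x + y)" for x y
    using assms by (simp_all add: monoid_map_def)
  have "0 \<in> range h"
    using h(1) by (metis rangeI)
  moreover have "h x + h y \<in> range h" for x y
    unfolding h(2) by (rule rangeI)
  ultimately show ?thesis
    by (auto simp: submonoid_add_def)
qed

text \<open>The sums \<open>y + nsmul a t\<close> already form a submonoid containing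
  \<open>insert t T\<close>, so the hull is no larger. Inductions over finite generating sets adjoin
  one generator at a time in this form.\<close>

lemma submonoid_hull_insertE:
  assumes "x \<in> submonoid_add hull (insert t T)"
  obtains y a where "y \<in> submonoid_add hull T" "x = y + nsmul a t"
proof -
  let ?M = "{x. \<exists>y\<in>submonoid_add hull T. \<exists>a. x = y + nsmul a t}"
  have "submonoid_add hull (insert t T) \<subseteq> ?M"
  proof (rule hull_minimal)
    show "submonoid_add ?M"
    proof (rule submonoid_addI)
      have "0 = 0 + nsmul 0 t"
        by simp
      then show "0 \<in> ?M"
        using submonoid_zero[OF submonoid_hull[of T]] by blast
      fix x x' assume "x \<in> ?M" "x' \<in> ?M"
      then obtain y y' a a' where y: "y \<in> submonoid_add hull T" "y' \<in> submonoid_add hull T"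
        and x: "x = y + nsmul a t" "x' = y' + nsmul a' t" by blast
      have "y + y' \<in> submonoid_add hull T"
        by (rule submonoid_add[OF submonoid_hull y])
      moreover have "x + x' = (y + y') + nsmul (a + a') t"
        using x by (simp add: nsmul_add_left add_ac)
      ultimately show "x + x' \<in> ?M" by blast
    qed
    have "0 + nsmul 1 t \<in> ?M"
      using submonoid_zero[OF submonoid_hull[of T]] by blast
    moreover have "s + nsmul 0 t \<in> ?M" if "s \<in> T" for s
      using hull_inc[OF that] by blast
    ultimately show "insert t T \<subseteq> ?M" by auto
  qed
  then show thesis using assms that by blast
qed

section \<open>Faces and units\<close>

lemma face_submonoid: "face G \<Longrightarrow> submonoid_add G"
  by (simp add: face_def)

lemma face_add_iff: "face G \<Longrightarrow> x + y \<in> G \<longleftrightarrow> x \<in> G \<and> y \<in> G"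
  unfolding face_def using submonoid_add by blast

lemma face_iff: "face G \<longleftrightarrow> 0 \<in> G \<and> (\<forall>x y. x + y \<in> G \<longleftrightarrow> x \<in> G \<and> y \<in> G)"
proof
  assume "face G"
  then show "0 \<in> G \<and> (\<forall>x y. x + y \<in> G \<longleftrightarrow> x \<in> G \<and> y \<in> G)"
    using submonoid_zero[OF face_submonoid] face_add_iff by auto
qed (simp add: face_def submonoid_add_def)

text \<open>A face contains the summands of its elements, so an expression in generators uses only
  generators in \<open>G\<close>. Thus \<open>S \<inter> G\<close> determines \<open>G\<close>,
  which makes induction on the number of these generators possible.\<close>

lemma face_hull_generators:
  assumes G: "face G" and S: "submonoid_add hull S = UNIV"
  shows "G = submonoid_add hull (S \<inter> G)"
proof
  show "submonoid_add hull (S \<inter> G) \<subseteq> G"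
    using face_submonoid[OF G] by (intro hull_minimal) auto
  have "x \<in> submonoid_add hull S \<Longrightarrow> x \<in> G \<longrightarrow> x \<in> submonoid_add hull (S \<inter> G)" for x
  proof (erule hull_induct)
    show "submonoid_add {x. x \<in> G \<longrightarrow> x \<in> submonoid_add hull (S \<inter> G)}"
      unfolding submonoid_add_def[of "Collect _"] mem_Collect_eq face_add_iff[OF G]
      using submonoid_zero[OF submonoid_hull] submonoid_add[OF submonoid_hull] by blast
  qed (auto intro: hull_inc)
  then show "G \<subseteq> submonoid_add hull (S \<inter> G)" using S by auto
qed

lemma face_nsmul_iff: "face G \<Longrightarrow> n > 0 \<Longrightarrow> nsmul n x \<in> G \<longleftrightarrow> x \<in> G"
  using submonoid_nsmul[OF face_submonoid] by (cases n) (auto simp: face_add_iff nsmul_Suc)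

lemma face_vimage: "monoid_map h \<Longrightarrow> face F \<Longrightarrow> face (h -` F)"
  by (simp add: face_iff monoid_map_def)

lemma units_add_sub_face:
  fixes F :: "'a::comm_monoid_add set"
  assumes "face F"
  shows "(units_add :: 'a set) \<subseteq> F"
proof
  fix x :: 'a assume "x \<in> units_add"
  then obtain y where "x + y = 0" by (auto simp: units_add_def)
  then have "x + y \<in> F" using submonoid_zero[OF face_submonoid[OF assms]] by simp
  then show "x \<in> F" by (simp add: face_add_iff[OF assms])
qed

lemma units_addD: "x + y \<in> units_add \<Longrightarrow> x \<in> units_add"
  by (auto simp: units_add_def add.assoc)

lemma face_units_add: "face (units_add :: 'a::comm_monoid_add set)"
proof -
  have "x + y \<in> units_add" if "x \<in> units_add" "y \<in> units_add" for x y :: 'a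
  proof -
    obtain x' y' where "x + x' = 0" "y + y' = 0"
      using \<open>x \<in> units_add\<close> \<open>y \<in> units_add\<close> by (auto simp: units_add_def)
    then have "(x + y) + (x' + y') = 0"
      by (metis add.assoc add.left_commute add.right_neutral)
    then show ?thesis by (auto simp: units_add_def)
  qed
  moreover have "0 \<in> (units_add :: 'a set)" by (auto simp: units_add_def intro: exI[of _ 0])
  ultimately show ?thesis
    unfolding face_def submonoid_add_def using units_addD by (metis add.commute)
qed

text \<open>The least face containing \<open>t\<close>, described as the set of elements that divide
  some multiple of \<open>t\<close>.\<close>

definition face_of :: "'a::comm_monoid_add \<Rightarrow> 'a set" where
  "face_of t = {x. \<exists>k y. nsmul k t = x + y}"

lemma face_face_of: "face (face_of t)"
  unfolding face_def submonoid_add_def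
proof (intro conjI ballI allI impI)
  show "0 \<in> face_of t"
    by (auto simp: face_of_def intro: exI[of _ 0])
  fix x y assume "x \<in> face_of t" "y \<in> face_of t"
  then obtain k l x' y' where "nsmul k t = x + x'" "nsmul l t = y + y'"
    by (auto simp: face_of_def)
  then have "nsmul (k + l) t = (x + y) + (x' + y')"
    by (simp add: nsmul_add_left add_ac)
  then show "x + y \<in> face_of t" by (auto simp: face_of_def)
next
  fix x y assume "x + y \<in> face_of t"
  then obtain k z where "nsmul k t = x + y + z" by (auto simp: face_of_def)
  then have "nsmul k t = x + (y + z)" "nsmul k t = y + (x + z)" by (simp_all add: add_ac)
  then show "x \<in> face_of t" "y \<in> face_of t"
    unfolding face_of_def by blast+
qed

lemma face_of_self: "t \<in> face_of t"
proof -
  have "nsmul 1 t = t + 0"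
    by simp
  then show ?thesis
    unfolding face_of_def by blast
qed

lemma face_of_minimal: "face G \<Longrightarrow> t \<in> G \<Longrightarrow> face_of t \<subseteq> G"
proof
  fix x assume G: "face G" "t \<in> G" and "x \<in> face_of t"
  then obtain k y where "nsmul k t = x + y" by (auto simp: face_of_def)
  then have "x + y \<in> G"
    using submonoid_nsmul[OF face_submonoid[OF G(1)] G(2)] by metis
  then show "x \<in> G" by (simp add: face_add_iff[OF G(1)])
qed

lemma fine_monoid_cancel:
  fixes a b c :: "'a::comm_monoid_add"
  assumes "fine_monoid TYPE('a)" "a + c = b + c"
  shows "a = b"
proof -
  have "to_gp a = to_gp b"
    using assms(2) by (auto simp: to_gp.abs_eq gp.abs_eq_iff gp_rel_def)
  then show ?thesis
    using assms(1) by (simp add: fine_monoid_def inj_eq)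
qed

lemma fine_monoid_generators:
  assumes "fine_monoid TYPE('a::comm_monoid_add)"
  obtains S :: "'a::comm_monoid_add set" where "finite S" "submonoid_add hull S = UNIV"
  using assms by (auto simp: fine_monoid_def)

section \<open>Dense maps\<close>

context
  fixes h :: "'q::comm_monoid_add \<Rightarrow> 'p::comm_monoid_add"
  assumes hom: "monoid_map h"
begin

lemma monoid_map_zero: "h 0 = 0" and monoid_map_add: "h (x + y) = h x + h y"
  using hom by (auto simp: monoid_map_def)

lemma finite_imp_dense:
  assumes fine: "fine_monoid TYPE('p)" and "finite_map h"
  shows "dense_map h"
  unfolding dense_map_iff
proof
  fix p
  obtain S where S: "finite S" "\<And>x. \<exists>q. \<exists>s\<in>S. x = h q + s"
    using assms(2) by (auto simp: finite_map_def)
  obtain f where f: "\<And>s. f s \<in> S \<and> (\<exists>q. p + s = h q + f s)"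
    using S(2)[of "p + _"] by metis
  have iter: "\<exists>q. nsmul n p + s = h q + (f ^^ n) s" for n s
  proof (induction n)
    case 0
    show ?case by (intro exI[of _ 0]) (simp add: monoid_map_zero)
  next
    case (Suc n)
    then obtain q where "nsmul n p + s = h q + (f ^^ n) s" by blast
    moreover obtain q' where "p + (f ^^ n) s = h q' + (f ^^ Suc n) s" using f by auto
    ultimately have "nsmul (Suc n) p + s = h (q + q') + (f ^^ Suc n) s"
      unfolding nsmul_Suc monoid_map_add by (metis add.assoc add.left_commute)
    then show ?case ..
  qed
  \<comment> \<open>The powers start at \<open>Suc n\<close> because 0 need not lie in
    \<open>S\<close>, whereas every value of \<open>f\<close> does.\<close>
  have "\<not> inj (\<lambda>n. (f ^^ Suc n) 0)"
  proof
    assume "inj (\<lambda>n. (f ^^ Suc n) 0)"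
    moreover have "finite (range (\<lambda>n. (f ^^ Suc n) 0))"
      by (rule finite_subset[OF _ S(1)]) (use f in auto)
    ultimately show False using finite_imageD infinite_UNIV_nat by blast
  qed
  then obtain i j where ij: "i < j" "(f ^^ Suc i) 0 = (f ^^ Suc j) 0"
    by (metis (no_types, lifting) injI linorder_neqE_nat)
  let ?s = "(f ^^ Suc i) 0"
  have "(f ^^ (j - i)) ?s = (f ^^ (j - i + Suc i)) 0"
    by (simp only: funpow_add o_apply)
  also have "\<dots> = ?s"
    using ij by simp
  finally obtain q where "nsmul (j - i) p + ?s = h q + ?s"
    using iter by metis
  then have "nsmul (j - i) p = h q"
    using fine_monoid_cancel[OF fine] by blast
  then show "\<exists>n>0. nsmul n p \<in> range h"
    using ij(1) by (intro exI[of _ "j - i"]) auto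
qed

text \<open>If \<open>nsmul n t\<close> lies in the image, the coefficient of a generator
  \<open>t\<close> matters only modulo \<open>n\<close>, so finitely many remainders
  suffice.\<close>

lemma dense_imp_finite:
  assumes fine: "fine_monoid TYPE('p)" and dense: "dense_map h"
  shows "finite_map h"
proof -
  have main: "\<exists>R. finite R \<and> (\<forall>x\<in>submonoid_add hull T. \<exists>q. \<exists>r\<in>R. x = h q + r)" if "finite T" for T
    using that
  proof (induction T rule: finite_induct)
    case empty
    have "submonoid_add hull {} \<subseteq> {0::'p}"
      by (rule hull_minimal) (auto simp: submonoid_add_def)
    then show ?case
      by (intro exI[of _ "{0}"]) (auto intro!: exI[of _ 0] simp: monoid_map_zero)
  next
    case (insert t T)
    then obtain R where R: "finite R" "\<And>x. x \<in> submonoid_add hull T \<Longrightarrow> \<exists>q. \<exists>r\<in>R. x = h q + r"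
      by blast
    obtain n q where n: "n > 0" "nsmul n t = h q"
      by (rule dense_mapE[OF dense])
    let ?R = "(\<lambda>(k, r). nsmul k t + r) ` ({..<n} \<times> R)"
    have "\<exists>q. \<exists>r\<in>?R. x = h q + r" if x: "x \<in> submonoid_add hull (insert t T)" for x
    proof -
      obtain y a where y: "y \<in> submonoid_add hull T" "x = y + nsmul a t"
        using submonoid_hull_insertE[OF x] .
      obtain q' r where r: "r \<in> R" "y = h q' + r"
        using R(2)[OF y(1)] by blast
      have "nsmul a t = nsmul (a div n * n + a mod n) t"
        by simp
      also have "\<dots> = h (nsmul (a div n) q) + nsmul (a mod n) t"
        unfolding nsmul_add_left nsmul_nsmul[symmetric] n(2) monoid_map_nsmul[OF hom] ..
      finally have "x = h (q' + nsmul (a div n) q) + (nsmul (a mod n) t + r)"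
        using y(2) r(2) by (simp add: monoid_map_add add_ac)
      moreover have "nsmul (a mod n) t + r \<in> ?R"
        using r n by (intro image_eqI[of _ _ "(a mod n, r)"]) auto
      ultimately show ?thesis by blast
    qed
    then show ?case
      using R(1) by (intro exI[of _ ?R]) auto
  qed
  obtain S :: "'p set" where "finite S" "submonoid_add hull S = UNIV"
    using fine_monoid_generators[OF fine] .
  with main[of S] show ?thesis
    by (auto simp: finite_map_def)
qed

text \<open>A face contains an element as soon as it contains a positive multiple. Hence
  \<open>F\<close> can be recovered from its preimage, which gives injectivity of
  \<open>Spec_map h\<close>.\<close>

lemma dense_face_eq:
  assumes dense: "dense_map h" and "face F"
  shows "p \<in> F \<longleftrightarrow> (\<exists>n>0. \<exists>q\<in>h -` F. nsmul n p = h q)"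
proof
  assume "p \<in> F"
  moreover obtain n q where n: "n > 0" "nsmul n p = h q"
    by (rule dense_mapE[OF dense])
  ultimately have "h q \<in> F"
    using face_nsmul_iff[OF \<open>face F\<close>] by metis
  with n show "\<exists>n>0. \<exists>q\<in>h -` F. nsmul n p = h q"
    by auto
next
  assume "\<exists>n>0. \<exists>q\<in>h -` F. nsmul n p = h q"
  then show "p \<in> F"
    using face_nsmul_iff[OF \<open>face F\<close>] by (metis vimageE)
qed

text \<open>By \<open>dense_face_eq\<close> the only candidate consists of the elements with a
  positive multiple in the image of \<open>G\<close>; it remains to see that this set is a
  face.\<close>

lemma dense_face_lift:
  assumes dense: "dense_map h" and inj: "inj h" and G: "face G"
  obtains F where "face F" "h -` F = G"
proof -
  define F where "F = {p. \<exists>n>0. \<exists>q\<in>G. nsmul n p = h q}"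
  \<comment> \<open>Any single multiple in the image decides membership: two of them have a common
    multiple, and injectivity of \<open>h\<close> carries the comparison back to the source.\<close>
  have iff: "nsmul n p = h q \<Longrightarrow> n > 0 \<Longrightarrow> p \<in> F \<longleftrightarrow> q \<in> G" for p n q
  proof
    assume n: "nsmul n p = h q" "n > 0" and "p \<in> F"
    then obtain m q' where m: "m > 0" "q' \<in> G" "nsmul m p = h q'"
      by (auto simp: F_def)
    have "h (nsmul m q) = h (nsmul n q')"
      using n m by (simp add: monoid_map_nsmul[OF hom] nsmul_nsmul mult.commute flip: n(1) m(3))
    then have "nsmul m q = nsmul n q'"
      using inj by (simp add: inj_eq)
    then have "nsmul m q \<in> G"
      using m(2) submonoid_nsmul[OF face_submonoid[OF G]] by simp
    then show "q \<in> G" using face_nsmul_iff[OF G] m by blast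
  qed (auto simp: F_def)
  have "face F"
    unfolding face_iff
  proof (intro conjI allI)
    show "p + p' \<in> F \<longleftrightarrow> p \<in> F \<and> p' \<in> F" for p p'
    proof -
      obtain n q where n: "n > 0" "nsmul n p = h q"
        by (rule dense_mapE[OF dense])
      obtain n' q' where n': "n' > 0" "nsmul n' p' = h q'"
        by (rule dense_mapE[OF dense])
      have 1: "nsmul (n * n') p = h (nsmul n' q)"
        by (simp add: monoid_map_nsmul[OF hom] nsmul_nsmul mult.commute flip: n(2))
      have 2: "nsmul (n * n') p' = h (nsmul n q')"
        by (simp add: monoid_map_nsmul[OF hom] nsmul_nsmul mult.commute flip: n'(2))
      have "nsmul (n * n') (p + p') = h (nsmul n' q + nsmul n q')"
        using 1 2 by (simp add: nsmul_add_right monoid_map_add)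
      then have "p + p' \<in> F \<longleftrightarrow> nsmul n' q + nsmul n q' \<in> G"
        by (rule iff) (use n n' in simp)
      also have "\<dots> \<longleftrightarrow> nsmul n' q \<in> G \<and> nsmul n q' \<in> G"
        by (rule face_add_iff[OF G])
      also have "\<dots> \<longleftrightarrow> p \<in> F \<and> p' \<in> F"
        using iff[OF 1] iff[OF 2] n n' by simp
      finally show ?thesis .
    qed
    show "0 \<in> F"
      using submonoid_zero[OF face_submonoid[OF G]] iff[of 1 0 0] by (simp add: monoid_map_zero)
  qed
  moreover have "h -` F = G"
    using iff[of 1 "h _"] by auto
  ultimately show thesis using that by blast
qed

text \<open>When \<open>nsmul n p = h q\<close>, the basic open set of \<open>p\<close> maps onto
  that of \<open>q\<close>, and preimages of basic open sets are basic open. So the map is open and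
  continuous; bijectivity comes from \<open>dense_face_lift\<close> and
  \<open>dense_face_eq\<close>.\<close>

lemma dense_imp_homeomorphic:
  assumes dense: "dense_map h" and inj: "inj h"
  shows "homeomorphic_map Spec Spec (Spec_map h)"
proof (rule bijective_open_imp_homeomorphic_map)
  have img: "Spec_map h ` basic_open (p :: 'p) = basic_open q" if "nsmul n p = h q" "n > 0" for n p q
  proof (intro equalityI subsetI)
    fix G assume "G \<in> Spec_map h ` basic_open p"
    then show "G \<in> basic_open q"
      using that face_vimage[OF hom] face_nsmul_iff[of _ n p]
      by (auto simp: basic_open_def Spec_map_def)
  next
    fix G assume G: "G \<in> basic_open q"
    then obtain F where "face F" "h -` F = G"
      using dense_face_lift[OF dense inj] by (auto simp: basic_open_def)
    then show "G \<in> Spec_map h ` basic_open p"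
      using that face_nsmul_iff[of F n p] G
      by (auto simp: basic_open_def Spec_map_def intro!: image_eqI[of _ _ F])
  qed
  have vim: "{F \<in> topspace Spec. Spec_map h F \<in> basic_open q} = basic_open (h q)" for q
    using face_vimage[OF hom] by (auto simp: topspace_Spec basic_open_def Spec_map_def)
  have open_basic: "openin Spec (basic_open p)" for p :: "'a::comm_monoid_add"
    by (simp add: Spec_def topology_generated_by_Basis)
  show "continuous_map Spec Spec (Spec_map h)"
    unfolding Spec_def[where 'a='q]
  proof (rule continuous_on_generated_topo)
    show "openin Spec (Spec_map h -` U \<inter> topspace Spec)"
      if "U \<in> range basic_open" for U :: "'q set set"
    proof -
      obtain q where "U = basic_open q" using \<open>U \<in> range basic_open\<close> by blast
      then have "Spec_map h -` U \<inter> topspace Spec = basic_open (h q)"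
        using vim[of q] by auto
      then show ?thesis using open_basic by simp
    qed
    show "Spec_map h ` topspace Spec \<subseteq> \<Union> (range basic_open)"
      using face_vimage[OF hom] submonoid_zero[OF face_submonoid]
      by (auto simp: topspace_Spec Spec_map_def basic_open_def)
  qed
  show "open_map Spec Spec (Spec_map h)"
    unfolding open_map_def
  proof (intro allI impI)
    fix U :: "'p set set" assume "openin Spec U"
    then obtain \<B> where B: "\<B> \<subseteq> range basic_open" "U = \<Union>\<B>"
      by (auto simp: openin_Spec union_of_def subset_eq)
    have "openin Spec (Spec_map h ` V)" if "V \<in> \<B>" for V
    proof -
      obtain p where p: "V = basic_open p" using B \<open>V \<in> \<B>\<close> by blast
      obtain n q where "n > 0" "nsmul n p = h q"
        by (rule dense_mapE[OF dense])
      then show ?thesis using img p open_basic by metis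
    qed
    then show "openin Spec (Spec_map h ` U)"
      unfolding B(2) image_Union by (intro openin_Union) auto
  qed
  show "Spec_map h ` topspace Spec = topspace Spec"
  proof (intro equalityI subsetI)
    fix G assume "G \<in> Spec_map h ` topspace Spec"
    then show "G \<in> topspace Spec"
      using face_vimage[OF hom] by (auto simp: topspace_Spec Spec_map_def)
  next
    fix G :: "'q set" assume "G \<in> topspace Spec"
    then obtain F where "face F" "h -` F = G"
      using dense_face_lift[OF dense inj] by (auto simp: topspace_Spec)
    then show "G \<in> Spec_map h ` topspace Spec"
      by (auto simp: topspace_Spec Spec_map_def)
  qed
  show "inj_on (Spec_map h) (topspace Spec)"
  proof (rule inj_onI)
    fix F F' :: "'p set"
    assume "F \<in> topspace Spec" "F' \<in> topspace Spec" and eq: "Spec_map h F = Spec_map h F'"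
    then have "face F" "face F'" by (auto simp: topspace_Spec)
    have "p \<in> F \<longleftrightarrow> p \<in> F'" for p
      using dense_face_eq[OF dense \<open>face F\<close>, of p] dense_face_eq[OF dense \<open>face F'\<close>, of p] eq
      by (auto simp: Spec_map_def)
    then show "F = F'" by blast
  qed
qed

text \<open>The face of units of the source is the preimage of some face \<open>F\<close>. Since
  \<open>F\<close> contains all units of the target, their preimage consists of units.\<close>

lemma Spec_surjective_imp_local:
  assumes "Spec_map h ` topspace Spec = topspace Spec"
  shows "local_map h"
  unfolding local_map_def
proof
  have "units_add \<in> Spec_map h ` topspace Spec"
    unfolding assms by (simp add: topspace_Spec face_units_add)
  then obtain F where F: "face F" "h -` F = units_add"
    by (auto simp: topspace_Spec Spec_map_def)
  then show "h -` units_add \<subseteq> units_add"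
    using units_add_sub_face[OF F(1)] by blast
  show "units_add \<subseteq> h -` units_add"
    using units_add_sub_face[OF face_vimage[OF hom face_units_add]] .
qed

end

section \<open>Fibres of finite ring maps\<close>

text \<open>Replaces carrier-based prime ideals by closure conditions on a set in a type-class ring.
  Closure under negation is multiplication by -1.\<close>

lemma prime_spectrum_iff:
  fixes I :: "'r::comm_ring_1 set"
  shows "I \<in> prime_spectrum \<longleftrightarrow> 0 \<in> I \<and> (\<forall>a\<in>I. \<forall>b\<in>I. a + b \<in> I) \<and> (\<forall>x. \<forall>a\<in>I. x * a \<in> I) \<and>
    1 \<notin> I \<and> (\<forall>a b. a * b \<in> I \<longrightarrow> a \<in> I \<or> b \<in> I)" (is "_ \<longleftrightarrow> ?R")
proof
  let ?A = "ring_of_type_algebra :: 'r ring"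
  assume "I \<in> prime_spectrum"
  then interpret primeideal I ?A
    by (simp add: prime_spectrum_def)
  show ?R
    using additive_subgroup.zero_closed[OF is_additive_subgroup]
      additive_subgroup.a_closed[OF is_additive_subgroup] I_l_closed one_imp_carrier I_notcarr I_prime
    by (auto simp: ring_of_type_algebra_def)
next
  let ?A = "ring_of_type_algebra :: 'r ring"
  assume R: ?R
  have right: "a * x \<in> I" if "a \<in> I" for a x
    using R that by (metis mult.commute)
  have neg: "- a \<in> I" if "a \<in> I" for a
    using R that by (metis mult_minus1)
  have inv: "inv\<^bsub>add_monoid ?A\<^esub> a = - a" for a
  proof -
    interpret cring ?A
      by (rule cring_from_type_algebra)
    have "\<ominus>\<^bsub>?A\<^esub> a = - a"
      by (rule minus_equality) (auto simp: ring_of_type_algebra_def)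
    then show ?thesis by (simp add: a_inv_def)
  qed
  have "primeideal I ?A"
  proof (rule primeidealI2)
    show "additive_subgroup I ?A"
    proof (intro additive_subgroup.intro subgroup.intro)
      show "inv\<^bsub>add_monoid ?A\<^esub> x \<in> I" if "x \<in> I" for x
        using neg[OF that] inv by simp
    qed (use R in \<open>auto simp: ring_of_type_algebra_def\<close>)
  qed (use R right cring_from_type_algebra in \<open>auto simp: ring_of_type_algebra_def\<close>)
  then show "I \<in> prime_spectrum"
    by (simp add: prime_spectrum_def)
qed

context
  fixes I :: "'r::comm_ring_1 set"
  assumes prime: "I \<in> prime_spectrum"
begin

lemma prime_zero: "0 \<in> I"
  and prime_add: "a \<in> I \<Longrightarrow> b \<in> I \<Longrightarrow> a + b \<in> I"
  and prime_mult_left: "a \<in> I \<Longrightarrow> x * a \<in> I"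
  and prime_one: "1 \<notin> I"
  and primeD: "a * b \<in> I \<Longrightarrow> a \<in> I \<or> b \<in> I"
  using prime by (auto simp: prime_spectrum_iff)

lemma prime_mult_right: "a \<in> I \<Longrightarrow> a * x \<in> I"
  using prime_mult_left[of a x] by (simp add: mult.commute)

lemma prime_uminus: "a \<in> I \<Longrightarrow> - a \<in> I"
  using prime_mult_left[of a "-1"] by simp

lemma prime_diff: "a \<in> I \<Longrightarrow> b \<in> I \<Longrightarrow> a - b \<in> I"
  using prime_add[of a "- b"] prime_uminus[of b] by simp

lemma prime_sum: "(\<And>i. i \<in> A \<Longrightarrow> f i \<in> I) \<Longrightarrow> sum f A \<in> I"
  by (induction A rule: infinite_finite_induct) (auto simp: prime_zero prime_add)

lemma prime_prod: "finite A \<Longrightarrow> i \<in> A \<Longrightarrow> f i \<in> I \<Longrightarrow> prod f A \<in> I"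
  by (simp add: prod.remove prime_mult_right)

lemma prime_prodD: "prod f A \<in> I \<Longrightarrow> \<exists>i\<in>A. f i \<in> I"
  by (induction A rule: infinite_finite_induct) (auto simp: prime_one dest: primeD)

lemma prime_power: "x ^ n \<in> I \<Longrightarrow> x \<in> I"
  by (induction n) (auto simp: prime_one dest: primeD)

text \<open>Gaussian elimination over the domain of residues modulo the prime.\<close>

lemma linear_dependence_mod_prime:
  fixes c :: "'i \<Rightarrow> 'j \<Rightarrow> 'r"
  assumes "finite J" "card J < card A"
  shows "\<exists>a. (\<exists>i\<in>A. a i \<notin> I) \<and> (\<forall>j\<in>J. (\<Sum>i\<in>A. a i * c i j) \<in> I)"
  using assms
proof (induction J arbitrary: A c rule: finite_induct)
  case empty
  then obtain i where "i \<in> A" by fastforce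
  then show ?case
    by (intro exI[of _ "\<lambda>_. 1"]) (auto simp: prime_one)
next
  case (insert j J)
  have fin: "finite A"
    using insert.prems card.infinite by fastforce
  show ?case
  proof (cases "\<forall>i\<in>A. c i j \<in> I")
    case True
    obtain a where a: "\<exists>i\<in>A. a i \<notin> I" "\<forall>j\<in>J. (\<Sum>i\<in>A. a i * c i j) \<in> I"
      using insert.IH[of A c] insert.prems insert.hyps by auto
    have "(\<Sum>i\<in>A. a i * c i j) \<in> I"
      using True by (intro prime_sum prime_mult_left) auto
    then show ?thesis
      using a by (intro exI[of _ a]) auto
  next
    case False
    then obtain k where k: "k \<in> A" "c k j \<notin> I" by blast
    define B where "B = A - {k}"
    have A: "A = insert k B" "k \<notin> B" "finite B"
      using k fin by (auto simp: B_def)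
    have "card J < card B"
      using A insert.prems insert.hyps by auto
    \<comment> \<open>Cross-multiplication with the pivot row \<open>k\<close> clears column
      \<open>j\<close> from the other rows without division.\<close>
    from insert.IH[OF this, of "\<lambda>i j'. c k j * c i j' - c i j * c k j'"]
    obtain a where a: "\<exists>i\<in>B. a i \<notin> I"
      and sum: "\<And>j'. j' \<in> J \<Longrightarrow> (\<Sum>i\<in>B. a i * (c k j * c i j' - c i j * c k j')) \<in> I"
      by blast
    \<comment> \<open>The coefficient of the pivot row is chosen to cancel column \<open>j\<close>;
      in every column the sum then equals the one for the reduced rows.\<close>
    define a' where "a' i = (if i = k then - (\<Sum>i\<in>B. a i * c i j) else a i * c k j)" for i
    have eq: "(\<Sum>i\<in>A. a' i * c i j') = (\<Sum>i\<in>B. a i * (c k j * c i j' - c i j * c k j'))" for j'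
    proof -
      have "(\<Sum>i\<in>A. a' i * c i j') = a' k * c k j' + (\<Sum>i\<in>B. a' i * c i j')"
        using A by simp
      also have "(\<Sum>i\<in>B. a' i * c i j') = (\<Sum>i\<in>B. a i * c k j * c i j')"
        using A(2) by (intro sum.cong) (auto simp: a'_def)
      also have "a' k * c k j' = - (\<Sum>i\<in>B. a i * c i j * c k j')"
        by (simp add: a'_def sum_distrib_right)
      finally show ?thesis
        by (simp add: algebra_simps sum_subtractf)
    qed
    obtain i where i: "i \<in> B" "a i \<notin> I" using a by blast
    then have "a' i \<notin> I"
      using A(2) k primeD by (auto simp: a'_def)
    moreover have "(\<Sum>i\<in>A. a' i * c i j') \<in> I" if "j' \<in> insert j J" for j'
      using that sum by (auto simp: eq mult.commute prime_zero)
    ultimately show ?thesis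
      using i A by blast
  qed
qed

end

section \<open>Ring maps that make the target a finite module\<close>

locale comm_ring_map =
  fixes \<phi> :: "'r::comm_ring_1 \<Rightarrow> 's::comm_ring_1"
  assumes map_one: "\<phi> 1 = 1"
    and map_add: "\<phi> (a + b) = \<phi> a + \<phi> b"
    and map_mult: "\<phi> (a * b) = \<phi> a * \<phi> b"
begin

lemma map_zero: "\<phi> 0 = 0"
  using map_add[of 0 0] by simp

lemma map_sum: "\<phi> (sum f A) = (\<Sum>i\<in>A. \<phi> (f i))"
  by (induction A rule: infinite_finite_induct) (auto simp: map_zero map_add)

lemma vimage_prime: "\<qq> \<in> prime_spectrum \<Longrightarrow> \<phi> -` \<qq> \<in> prime_spectrum"
  by (auto simp: prime_spectrum_iff map_zero map_one map_add map_mult)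

end

locale module_finite_map = comm_ring_map \<phi>
  for \<phi> :: "'r::comm_ring_1 \<Rightarrow> 's::comm_ring_1" +
  fixes B :: "'s set"
  assumes finite_B: "finite B"
    and span_B: "\<exists>c. s = (\<Sum>b\<in>B. \<phi> (c b) * b)"
begin

lemma finite_type: "finite_type_ring_map \<phi>"
proof -
  let ?G = "generate_ring ring_of_type_algebra (range \<phi> \<union> B)"
  have add: "x + y \<in> ?G" and mult: "x * y \<in> ?G" if "x \<in> ?G" "y \<in> ?G" for x y
    using generate_ring.eng_add[OF that] generate_ring.eng_mult[OF that]
    by (auto simp: ring_of_type_algebra_def)
  have sum: "(\<Sum>b\<in>C. \<phi> (c b) * b) \<in> ?G" if "finite C" "C \<subseteq> B" for C c
    using that
  proof (induction C rule: finite_induct)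
    case empty
    have "\<phi> 0 \<in> ?G" by (intro generate_ring.incl) auto
    then show ?case by (simp add: map_zero)
  next
    case (insert b C)
    have "\<phi> (c b) \<in> ?G" "b \<in> ?G"
      using insert.prems by (auto intro: generate_ring.incl)
    then show ?case
      using insert by (simp add: add mult)
  qed
  have "s \<in> ?G" for s
    using span_B[of s] sum[OF finite_B order_refl] by metis
  then show ?thesis
    unfolding finite_type_ring_map_def using finite_B by blast
qed

text \<open>The coordinates of the \<open>x i\<close> in the generators \<open>B\<close> form a
  matrix with more rows than columns, hence dependent rows modulo \<open>\<pp>\<close>. Since
  \<open>\<phi>\<close> sends \<open>\<pp>\<close> into each prime over it, one relation serves the
  entire fibre.\<close>

lemma dependence_mod_fibre:
  fixes x :: "'i \<Rightarrow> 's"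
  assumes p: "\<pp> \<in> prime_spectrum" and "card B < card A"
  obtains a where "\<exists>i\<in>A. a i \<notin> \<pp>"
    and "\<And>\<qq>. \<qq> \<in> prime_spectrum \<Longrightarrow> \<phi> -` \<qq> = \<pp> \<Longrightarrow> (\<Sum>i\<in>A. \<phi> (a i) * x i) \<in> \<qq>"
proof -
  have "\<forall>i. \<exists>c. x i = (\<Sum>b\<in>B. \<phi> (c b) * b)"
    using span_B by blast
  from choice[OF this] obtain c where c: "\<And>i. x i = (\<Sum>b\<in>B. \<phi> (c i b) * b)"
    by blast
  obtain a where a: "\<exists>i\<in>A. a i \<notin> \<pp>" "\<forall>b\<in>B. (\<Sum>i\<in>A. a i * c i b) \<in> \<pp>"
    using linear_dependence_mod_prime[OF p finite_B assms(2)] by blast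
  have "(\<Sum>i\<in>A. \<phi> (a i) * x i) = (\<Sum>i\<in>A. \<Sum>b\<in>B. \<phi> (a i) * \<phi> (c i b) * b)"
    by (simp add: c sum_distrib_left mult.assoc)
  also have "\<dots> = (\<Sum>b\<in>B. \<Sum>i\<in>A. \<phi> (a i) * \<phi> (c i b) * b)"
    by (rule sum.swap)
  also have "\<dots> = (\<Sum>b\<in>B. \<phi> (\<Sum>i\<in>A. a i * c i b) * b)"
    by (simp add: map_sum map_mult sum_distrib_right)
  finally have eq: "(\<Sum>i\<in>A. \<phi> (a i) * x i) = (\<Sum>b\<in>B. \<phi> (\<Sum>i\<in>A. a i * c i b) * b)" .
  show thesis
  proof (rule that[OF a(1)])
    fix \<qq> assume "\<qq> \<in> prime_spectrum" "\<phi> -` \<qq> = \<pp>"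
    then show "(\<Sum>i\<in>A. \<phi> (a i) * x i) \<in> \<qq>"
      unfolding eq using a(2) by (intro prime_sum prime_mult_right) auto
  qed
qed

text \<open>An element \<open>x\<close> of \<open>\<qq>'\<close> outside \<open>\<qq>\<close>
  satisfies a nontrivial polynomial relation modulo \<open>\<qq>\<close>. Cancelling the power of
  \<open>x\<close> at the first coefficient outside \<open>\<qq>\<close> puts that coefficient into
  \<open>\<qq>'\<close>, contrary to equal contractions.\<close>

lemma incomparable:
  assumes q: "\<qq> \<in> prime_spectrum" and q': "\<qq>' \<in> prime_spectrum"
    and eq: "\<phi> -` \<qq> = \<phi> -` \<qq>'" and sub: "\<qq> \<subseteq> \<qq>'"
  shows "\<qq> = \<qq>'"
proof (rule ccontr)
  assume "\<qq> \<noteq> \<qq>'"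
  then obtain x where x: "x \<in> \<qq>'" "x \<notin> \<qq>" using sub by blast
  let ?N = "Suc (card B)"
  obtain a where a: "\<exists>i\<in>{..<?N}. a i \<notin> \<phi> -` \<qq>" and sum: "(\<Sum>i<?N. \<phi> (a i) * x ^ i) \<in> \<qq>"
    by (rule dependence_mod_fibre[OF vimage_prime[OF q], of "{..<?N}" "\<lambda>i. x ^ i"])
       (use q in auto)
  define m where "m = (LEAST i. i < ?N \<and> \<phi> (a i) \<notin> \<qq>)"
  have m: "m < ?N" "\<phi> (a m) \<notin> \<qq>"
    using a LeastI_ex[of "\<lambda>i. i < ?N \<and> \<phi> (a i) \<notin> \<qq>"] by (auto simp: m_def)
  have low: "\<phi> (a i) \<in> \<qq>" if "i < m" for i
    using not_less_Least[of i "\<lambda>i. i < ?N \<and> \<phi> (a i) \<notin> \<qq>"] that m by (auto simp: m_def)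
  let ?y = "\<Sum>i\<in>{Suc m..<?N}. \<phi> (a i) * x ^ (i - Suc m)"
  have "(\<Sum>i<?N. \<phi> (a i) * x ^ i) =
      (\<Sum>i<m. \<phi> (a i) * x ^ i) + (\<Sum>i\<in>{m..<?N}. \<phi> (a i) * x ^ i)"
    using m(1) by (simp add: lessThan_atLeast0 sum.atLeastLessThan_concat)
  also have "(\<Sum>i\<in>{m..<?N}. \<phi> (a i) * x ^ i) = \<phi> (a m) * x ^ m + (\<Sum>i\<in>{Suc m..<?N}. \<phi> (a i) * x ^ i)"
    using m(1) by (intro sum.atLeast_Suc_lessThan)
  also have "(\<Sum>i\<in>{Suc m..<?N}. \<phi> (a i) * x ^ i) = x ^ Suc m * ?y"
    unfolding sum_distrib_left
  proof (rule sum.cong[OF refl])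
    fix i assume "i \<in> {Suc m..<?N}"
    then have "x ^ i = x ^ Suc m * x ^ (i - Suc m)"
      by (simp flip: power_add del: power_Suc)
    then show "\<phi> (a i) * x ^ i = x ^ Suc m * (\<phi> (a i) * x ^ (i - Suc m))"
      by (simp add: mult_ac)
  qed
  finally have split: "(\<Sum>i<?N. \<phi> (a i) * x ^ i) =
      (\<Sum>i<m. \<phi> (a i) * x ^ i) + x ^ m * (\<phi> (a m) + x * ?y)"
    by (simp add: algebra_simps)
  have "(\<Sum>i<m. \<phi> (a i) * x ^ i) \<in> \<qq>"
    using low by (intro prime_sum[OF q] prime_mult_right[OF q]) auto
  from prime_diff[OF q sum this] have "x ^ m * (\<phi> (a m) + x * ?y) \<in> \<qq>"
    unfolding split by (simp only: add_diff_cancel_left')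
  then have "\<phi> (a m) + x * ?y \<in> \<qq>'"
    using primeD[OF q] prime_power[OF q] x sub by blast
  then have "\<phi> (a m) \<in> \<qq>'"
    using prime_diff[OF q' _ prime_mult_right[OF q' x(1), of ?y]] by force
  then have "a m \<in> \<phi> -` \<qq>'" by simp
  then show False using m eq by blast
qed

text \<open>Given more primes than module generators, incomparability yields elements \<open>e \<qq>\<close> lying in all of
  the primes except \<open>\<qq>\<close>; they are linearly independent modulo \<open>\<pp>\<close>.\<close>

lemma finite_fibre:
  assumes p: "\<pp> \<in> prime_spectrum"
  shows "finite {\<qq>\<in>prime_spectrum. \<phi> -` \<qq> = \<pp>}" (is "finite ?F")
proof (rule ccontr)
  assume "infinite ?F"
  then obtain A where A: "finite A" "card A = Suc (card B)" "A \<subseteq> ?F"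
    using infinite_arbitrarily_large by blast
  have "\<exists>y. y \<in> \<qq>' \<and> y \<notin> \<qq>" if "\<qq> \<in> A" "\<qq>' \<in> A" "\<qq>' \<noteq> \<qq>" for \<qq> \<qq>'
    using incomparable[of \<qq>' \<qq>] that A(3) by blast
  then obtain y where y: "\<And>\<qq> \<qq>'. \<qq> \<in> A \<Longrightarrow> \<qq>' \<in> A \<Longrightarrow> \<qq>' \<noteq> \<qq> \<Longrightarrow> y \<qq> \<qq>' \<in> \<qq>' \<and> y \<qq> \<qq>' \<notin> \<qq>"
    by metis
  define e where "e \<qq> = (\<Prod>\<qq>'\<in>A - {\<qq>}. y \<qq> \<qq>')" for \<qq>
  have e_in: "e \<qq> \<in> \<qq>'" if "\<qq> \<in> A" "\<qq>' \<in> A" "\<qq>' \<noteq> \<qq>" for \<qq> \<qq>'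
    unfolding e_def using that A y[OF that] by (intro prime_prod[of _ _ \<qq>']) auto
  have e_notin: "e \<qq> \<notin> \<qq>" if "\<qq> \<in> A" for \<qq>
    unfolding e_def using that A y prime_prodD[of \<qq>] by fastforce
  obtain a where a: "\<exists>\<qq>\<in>A. a \<qq> \<notin> \<pp>"
    and sum: "\<And>\<qq>. \<qq> \<in> ?F \<Longrightarrow> (\<Sum>i\<in>A. \<phi> (a i) * e i) \<in> \<qq>"
    by (rule dependence_mod_fibre[OF p, of A e]) (use A in auto)
  obtain \<qq> where q: "\<qq> \<in> A" "a \<qq> \<notin> \<pp>" using a by blast
  then have qF: "\<qq> \<in> prime_spectrum" "\<phi> -` \<qq> = \<pp>" using A by auto
  \<comment> \<open>Modulo \<open>\<qq>\<close> every other \<open>e i\<close> vanishes, so the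
    relation isolates the term at \<open>\<qq>\<close>, where neither factor vanishes.\<close>
  have "(\<Sum>i\<in>A. \<phi> (a i) * e i) = \<phi> (a \<qq>) * e \<qq> + (\<Sum>i\<in>A-{\<qq>}. \<phi> (a i) * e i)"
    using A q by (simp add: sum.remove)
  moreover have "(\<Sum>i\<in>A-{\<qq>}. \<phi> (a i) * e i) \<in> \<qq>"
    using e_in q by (intro prime_sum[OF qF(1)] prime_mult_left[OF qF(1)]) auto
  ultimately have "\<phi> (a \<qq>) * e \<qq> \<in> \<qq>"
    using prime_diff[OF qF(1) sum[of \<qq>]] qF by force
  then have "\<phi> (a \<qq>) \<in> \<qq>"
    using primeD[OF qF(1)] e_notin q by blast
  then show False using q qF by blast
qed

lemma quasi_finite: "quasi_finite_ring_map \<phi>"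
  by (simp add: quasi_finite_ring_map_def finite_type finite_fibre)

end

section \<open>Monoid algebras\<close>

text \<open>The linear extension of \<open>\<chi>\<close> to the monoid algebra; for a
  multiplicative \<open>\<chi>\<close> it is multiplicative too. Real values leave room for the real
  powers used as characters below.\<close>

definition monoid_algebra_eval :: "('a \<Rightarrow> real) \<Rightarrow> ('a \<Rightarrow>\<^sub>0 int) \<Rightarrow> real" where
  "monoid_algebra_eval \<chi> x = (\<Sum>k\<in>Poly_Mapping.keys x. of_int (Poly_Mapping.lookup x k) * \<chi> k)"

lemma monoid_algebra_eval_superset:
  assumes "finite A" "Poly_Mapping.keys x \<subseteq> A"
  shows "monoid_algebra_eval \<chi> x = (\<Sum>k\<in>A. of_int (Poly_Mapping.lookup x k) * \<chi> k)"
  unfolding monoid_algebra_eval_def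
  by (rule sum.mono_neutral_left) (use assms in \<open>auto simp: in_keys_iff\<close>)

lemma monoid_algebra_eval_of [simp]: "monoid_algebra_eval \<chi> (frag_of a) = \<chi> a"
  by (simp add: monoid_algebra_eval_def)

lemma monoid_algebra_eval_0 [simp]: "monoid_algebra_eval \<chi> 0 = 0"
  by (simp add: monoid_algebra_eval_def)

lemma monoid_algebra_eval_diff:
  "monoid_algebra_eval \<chi> (x - y) = monoid_algebra_eval \<chi> x - monoid_algebra_eval \<chi> y"
proof -
  let ?A = "Poly_Mapping.keys x \<union> Poly_Mapping.keys y"
  have "monoid_algebra_eval \<chi> (x - y) = (\<Sum>k\<in>?A. of_int (Poly_Mapping.lookup (x - y) k) * \<chi> k)"
    by (rule monoid_algebra_eval_superset) (use keys_diff[of x y] in auto)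
  also have "\<dots> = monoid_algebra_eval \<chi> x - monoid_algebra_eval \<chi> y"
    by (simp add: monoid_algebra_eval_superset[of ?A] lookup_minus algebra_simps sum_subtractf)
  finally show ?thesis .
qed

lemma monoid_algebra_eval_add:
  "monoid_algebra_eval \<chi> (x + y) = monoid_algebra_eval \<chi> x + monoid_algebra_eval \<chi> y"
  using monoid_algebra_eval_diff[of \<chi> "x + y" y] by simp

lemma monoid_algebra_eval_mult:
  fixes \<chi> :: "'a::comm_monoid_add \<Rightarrow> real"
  assumes "\<And>a b. \<chi> (a + b) = \<chi> a * \<chi> b"
  shows "monoid_algebra_eval \<chi> (x * y) = monoid_algebra_eval \<chi> x * monoid_algebra_eval \<chi> y"
  using subset_UNIV
proof (induction x rule: frag_induction)
  case (one a)
  show ?case using subset_UNIV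
    by (induction y rule: frag_induction)
       (auto simp: mult_single assms right_diff_distrib monoid_algebra_eval_diff)
qed (auto simp: left_diff_distrib monoid_algebra_eval_diff)

lemma monoid_algebra_eval_kernel_prime:
  fixes \<chi> :: "'a::comm_monoid_add \<Rightarrow> real"
  assumes "\<chi> 0 = 1" and mult: "\<And>a b. \<chi> (a + b) = \<chi> a * \<chi> b"
  shows "{x. monoid_algebra_eval \<chi> x = 0} \<in> prime_spectrum"
proof -
  have "monoid_algebra_eval \<chi> 1 = 1"
    using monoid_algebra_eval_of[of \<chi> 0] assms(1) by simp
  then show ?thesis
    by (auto simp: prime_spectrum_iff monoid_algebra_eval_add monoid_algebra_eval_mult[of \<chi>, OF mult])
qed

lemma monoid_algebra_eval_map:
  "monoid_algebra_eval \<chi> (monoid_algebra_map h x) = monoid_algebra_eval (\<chi> \<circ> h) x"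
  using subset_UNIV unfolding monoid_algebra_map_def
  by (induction x rule: frag_induction) (auto simp: frag_extend_diff monoid_algebra_eval_diff)

lemma monoid_algebra_map_of [simp]: "monoid_algebra_map h (frag_of a) = frag_of (h a)"
  by (simp add: monoid_algebra_map_def)

lemma comm_ring_map_monoid_algebra_map:
  assumes "monoid_map h"
  shows "comm_ring_map (monoid_algebra_map h)"
proof
  have h: "h 0 = 0" "\<And>x y. h (x + y) = h x + h y"
    using assms by (auto simp: monoid_map_def)
  show "monoid_algebra_map h 1 = 1"
    using monoid_algebra_map_of[of h 0] h by simp
  show "monoid_algebra_map h (a + b) = monoid_algebra_map h a + monoid_algebra_map h b" for a b
    by (simp add: monoid_algebra_map_def frag_extend_add)
  show "monoid_algebra_map h (a * b) = monoid_algebra_map h a * monoid_algebra_map h b" for a b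
    using subset_UNIV unfolding monoid_algebra_map_def
  proof (induction a rule: frag_induction)
    case (one a)
    show ?case using subset_UNIV
      by (induction b rule: frag_induction)
         (auto simp: mult_single h right_diff_distrib frag_extend_diff)
  qed (auto simp: left_diff_distrib frag_extend_diff)
qed

text \<open>The basis element at \<open>h q + s\<close> is the product of those at
  \<open>h q\<close> and \<open>s\<close>. So the basis elements at \<open>S\<close> generate the
  target algebra as a module over the source algebra, and \<open>module_finite_map\<close>
  applies.\<close>

lemma finite_imp_quasi_finite:
  assumes h: "monoid_map h" and "finite_map h"
  shows "quasi_finite_map h"
proof -
  obtain S where S: "finite S" "\<And>p. \<exists>q. \<exists>s\<in>S. p = h q + s"
    using assms(2) by (auto simp: finite_map_def)
  interpret comm_ring_map "monoid_algebra_map h"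
    using h by (rule comm_ring_map_monoid_algebra_map)
  have "\<exists>c. x = (\<Sum>b\<in>frag_of ` S. monoid_algebra_map h (c b) * b)" for x
    using subset_UNIV
  proof (induction x rule: frag_induction)
    case zero
    show ?case by (intro exI[of _ "\<lambda>_. 0"]) (simp add: map_zero)
  next
    case (one p)
    obtain q s where "s \<in> S" "p = h q + s" using S by blast
    then have "frag_of p = (\<Sum>b\<in>frag_of ` S. if b = frag_of s then frag_of (h q) * b else 0)"
      using S(1) by (simp add: mult_single)
    also have "\<dots> = (\<Sum>b\<in>frag_of ` S. monoid_algebra_map h (if b = frag_of s then frag_of q else 0) * b)"
      by (intro sum.cong) (auto simp: map_zero)
    finally show ?case
      by (intro exI[of _ "\<lambda>b. if b = frag_of s then frag_of q else 0"])
  next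
    case (diff x y)
    then obtain c d where "x = (\<Sum>b\<in>frag_of ` S. monoid_algebra_map h (c b) * b)"
      "y = (\<Sum>b\<in>frag_of ` S. monoid_algebra_map h (d b) * b)" by blast
    then have "x - y = (\<Sum>b\<in>frag_of ` S. monoid_algebra_map h (c b - d b) * b)"
      by (simp add: monoid_algebra_map_def frag_extend_diff left_diff_distrib sum_subtractf)
    then show ?case by (intro exI[of _ "\<lambda>b. c b - d b"])
  qed
  then interpret module_finite_map "monoid_algebra_map h" "frag_of ` S"
    using S(1) by unfold_locales auto
  show ?thesis
    unfolding quasi_finite_map_def by (rule quasi_finite)
qed

section \<open>Extending additive functionals\<close>

lemma additive_nsmul:
  fixes \<phi> :: "'a::comm_monoid_add \<Rightarrow> real"
  assumes "submonoid_add M" and zero: "\<phi> 0 = 0"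
    and add: "\<And>x y. x \<in> M \<Longrightarrow> y \<in> M \<Longrightarrow> \<phi> (x + y) = \<phi> x + \<phi> y" and "x \<in> M"
  shows "\<phi> (nsmul n x) = n * \<phi> x"
  by (induction n)
     (auto simp: nsmul_Suc zero add[OF \<open>x \<in> M\<close> submonoid_nsmul[OF assms(1,4)]] algebra_simps)

text \<open>The value \<open>c\<close> at \<open>t\<close> is forced by a relation
  \<open>y = y' + nsmul k t\<close> with \<open>k > 0\<close>, and the reals permit division by
  \<open>k\<close>; without such a relation any \<open>c\<close> works, and 0 is taken. Cancellation
  makes the formula independent of the representation.\<close>

lemma extend_additive_insert:
  fixes \<phi> :: "'a::comm_monoid_add \<Rightarrow> real"
  assumes cancel: "\<And>a b c :: 'a. a + c = b + c \<Longrightarrow> a = b"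
    and M: "submonoid_add M" and zero: "\<phi> 0 = 0"
    and add: "\<And>x y. x \<in> M \<Longrightarrow> y \<in> M \<Longrightarrow> \<phi> (x + y) = \<phi> x + \<phi> y"
  obtains \<psi> c where "\<And>y a. y \<in> M \<Longrightarrow> \<psi> (y + nsmul a t) = \<phi> y + real a * c"
proof -
  have "\<exists>c. \<forall>y\<in>M. \<forall>y'\<in>M. \<forall>k. y = y' + nsmul k t \<longrightarrow> \<phi> y = \<phi> y' + real k * c"
  proof (cases "\<exists>k>0. \<exists>y\<in>M. \<exists>y'\<in>M. y = y' + nsmul k t")
    case True
    then obtain k0 y0 y0' where y0: "k0 > 0" "y0 \<in> M" "y0' \<in> M" "y0 = y0' + nsmul k0 t"
      by blast
    define c where "c = (\<phi> y0 - \<phi> y0') / real k0"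
    have "\<phi> y = \<phi> y' + real k * c" if y: "y \<in> M" "y' \<in> M" "y = y' + nsmul k t" for y y' k
    proof -
      \<comment> \<open>Scaling both relations to the same multiple of \<open>t\<close> eliminates
        \<open>t\<close>, so every relation forces the same \<open>c\<close>.\<close>
      have "nsmul k0 y + nsmul k y0' = nsmul k0 y' + nsmul k y0"
        unfolding y(3) y0(4) by (simp add: nsmul_add_right nsmul_nsmul add_ac mult.commute)
      then have "\<phi> (nsmul k0 y + nsmul k y0') = \<phi> (nsmul k0 y' + nsmul k y0)"
        by simp
      then have "real k0 * \<phi> y + real k * \<phi> y0' = real k0 * \<phi> y' + real k * \<phi> y0"
        using y y0 by (simp add: add submonoid_nsmul[OF M] additive_nsmul[OF M zero add])
      then show ?thesis
        using y0(1) by (simp add: c_def field_simps)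
    qed
    then show ?thesis by blast
  next
    case False
    then have "\<phi> y = \<phi> y' + real k * 0" if "y \<in> M" "y' \<in> M" "y = y' + nsmul k t" for y y' k
    proof -
      have "\<not> k > 0"
      proof
        assume "k > 0"
        then have "\<exists>k>0. \<exists>y\<in>M. \<exists>y'\<in>M. y = y' + nsmul k t"
          using that by (intro exI[of _ k] conjI bexI[of _ y] bexI[of _ y'])
        with False show False by contradiction
      qed
      then show ?thesis using that(3) by simp
    qed
    then show ?thesis by metis
  qed
  then obtain c where
    c: "\<And>y y' k. y \<in> M \<Longrightarrow> y' \<in> M \<Longrightarrow> y = y' + nsmul k t \<Longrightarrow> \<phi> y = \<phi> y' + real k * c"
    by blast
  have le: "\<phi> y + real a * c = \<phi> y' + real a' * c"
    if y: "y \<in> M" "y' \<in> M" "y + nsmul a t = y' + nsmul a' t" and "a \<le> a'" for y y' a a'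
  proof -
    have "nsmul a' t = nsmul (a' - a) t + nsmul a t"
      using \<open>a \<le> a'\<close> by (simp flip: nsmul_add_left)
    then have "y = y' + nsmul (a' - a) t"
      using y(3) by (intro cancel[of y "nsmul a t"]) (simp add: add.assoc)
    then have "\<phi> y = \<phi> y' + real (a' - a) * c" by (rule c[OF y(1,2)])
    then show ?thesis using \<open>a \<le> a'\<close> by (simp add: of_nat_diff algebra_simps)
  qed
  have wd: "\<phi> y + real a * c = \<phi> y' + real a' * c"
    if "y \<in> M" "y' \<in> M" "y + nsmul a t = y' + nsmul a' t" for y y' a a'
    using le[of y y' a a'] le[of y' y a' a] that by (cases "a \<le> a'") auto
  \<comment> \<open>A choice among the values from all representations; \<open>wd\<close> shows that
    they agree.\<close>
  define \<psi> where "\<psi> x = (SOME v. \<exists>y\<in>M. \<exists>a. x = y + nsmul a t \<and> v = \<phi> y + real a * c)" for x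
  have "\<psi> (y + nsmul a t) = \<phi> y + real a * c" if y: "y \<in> M" for y a
    unfolding \<psi>_def
  proof (rule some_equality)
    fix v assume "\<exists>y'\<in>M. \<exists>a'. y + nsmul a t = y' + nsmul a' t \<and> v = \<phi> y' + real a' * c"
    then show "v = \<phi> y + real a * c" using wd[OF y] by force
  qed (use y in blast)
  then show thesis using that by blast
qed

lemma extend_additive:
  fixes \<phi> :: "'a::comm_monoid_add \<Rightarrow> real"
  assumes cancel: "\<And>a b c :: 'a. a + c = b + c \<Longrightarrow> a = b"
    and N: "submonoid_add N" and zero: "\<phi> 0 = 0"
    and add: "\<And>x y. x \<in> N \<Longrightarrow> y \<in> N \<Longrightarrow> \<phi> (x + y) = \<phi> x + \<phi> y"
    and "finite T"
  shows "\<exists>\<psi>. (\<forall>x\<in>N. \<psi> x = \<phi> x) \<and>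
    (\<forall>x\<in>submonoid_add hull (T \<union> N). \<forall>y\<in>submonoid_add hull (T \<union> N). \<psi> (x + y) = \<psi> x + \<psi> y)"
  using \<open>finite T\<close>
proof (induction T rule: finite_induct)
  case empty
  have "submonoid_add hull N = N"
    using N by (rule hull_same)
  then show ?case
    using add by auto
next
  case (insert t T)
  let ?M = "submonoid_add hull (T \<union> N)"
  obtain \<psi> where \<psi>: "\<And>x. x \<in> N \<Longrightarrow> \<psi> x = \<phi> x"
    and add': "\<And>x y. x \<in> ?M \<Longrightarrow> y \<in> ?M \<Longrightarrow> \<psi> (x + y) = \<psi> x + \<psi> y"
    using insert.IH by blast
  have "\<psi> 0 = 0"
    using N zero \<psi> by (simp add: submonoid_add_def)
  then obtain \<omega> c where \<omega>: "\<And>y a. y \<in> ?M \<Longrightarrow> \<omega> (y + nsmul a t) = \<psi> y + real a * c"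
    using extend_additive_insert[of ?M \<psi> t thesis] cancel submonoid_hull add' by metis
  have "\<omega> x = \<phi> x" if "x \<in> N" for x
    using \<omega>[of x 0] \<psi> that hull_inc[of x "T \<union> N"] by simp
  moreover have "\<omega> (x + x') = \<omega> x + \<omega> x'"
    if x: "x \<in> submonoid_add hull (insert t T \<union> N)" and x': "x' \<in> submonoid_add hull (insert t T \<union> N)"
    for x x'
  proof -
    obtain y a where y: "y \<in> ?M" "x = y + nsmul a t"
      by (rule submonoid_hull_insertE[OF x[unfolded Un_insert_left]])
    obtain y' a' where y': "y' \<in> ?M" "x' = y' + nsmul a' t"
      by (rule submonoid_hull_insertE[OF x'[unfolded Un_insert_left]])
    have "x + x' = (y + y') + nsmul (a + a') t"
      unfolding y y' by (simp add: nsmul_add_left add_ac)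
    then have "\<omega> (x + x') = \<psi> (y + y') + real (a + a') * c"
      using \<omega>[OF submonoid_add[OF submonoid_hull y(1) y'(1)]] by metis
    also have "\<dots> = \<omega> x + \<omega> x'"
      unfolding y(2) y'(2) \<omega>[OF y(1)] \<omega>[OF y'(1)] add'[OF y(1) y'(1)] by (simp add: algebra_simps)
    finally show ?thesis .
  qed
  ultimately show ?case by blast
qed

text \<open>In the groupification the equation reads \<open>nsmul n p = h q' - h q\<close>: every
  element of \<open>G\<close> is torsion modulo the differences of image elements from the preimage
  of \<open>G\<close>. The term \<open>h q\<close> stays because it need not be invertible.\<close>

lemma quasi_finite_face_torsion:
  fixes h :: "'q::comm_monoid_add \<Rightarrow> 'p::comm_monoid_add"
  assumes hom: "monoid_map h" and fine: "fine_monoid TYPE('p)"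
    and qf: "quasi_finite_map h" and G: "face G" and p: "p \<in> G"
  shows "\<exists>n>0. \<exists>q\<in>h -` G. \<exists>q'\<in>h -` G. nsmul n p + h q = h q'"
proof (rule ccontr)
  assume no: "\<not> ?thesis"
  note cancel = fine_monoid_cancel[OF fine]
  have Gsub: "submonoid_add G" using G by (simp add: face_def)
  have H: "submonoid_add (h -` G)" using face_vimage[OF hom G] by (simp add: face_def)
  have H0: "h 0 = 0" "0 \<in> h -` G" "\<And>x y. h (x + y) = h x + h y"
    using H hom by (auto simp: submonoid_add_def monoid_map_def)
  \<comment> \<open>The submonoid generated by \<open>p\<close> and the image of the preimage of
    \<open>G\<close>. Under the assumption for contradiction the coefficient of \<open>p\<close> is
    unique, and \<open>\<phi>\<close> will read it off.\<close>
  define N where "N = {nsmul n p + h q |n q. q \<in> h -` G}"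
  have le: "n = n'" if "nsmul n p + h q = nsmul n' p + h q'" "q \<in> h -` G" "q' \<in> h -` G" "n \<le> n'" for n n' q q'
  proof (rule ccontr)
    assume "n \<noteq> n'"
    have eq: "nsmul n' p = nsmul (n' - n) p + nsmul n p"
      using \<open>n \<le> n'\<close> by (simp flip: nsmul_add_left)
    have "nsmul (n' - n) p + h q' + nsmul n p = h q + nsmul n p"
      using that(1)[symmetric] unfolding eq by (simp only: add_ac)
    then have "nsmul (n' - n) p + h q' = h q"
      by (rule cancel)
    moreover have "n' - n > 0"
      using \<open>n \<le> n'\<close> \<open>n \<noteq> n'\<close> by simp
    ultimately show False
      using no that(2,3) by blast
  qed
  have uniq: "n = n'" if "nsmul n p + h q = nsmul n' p + h q'" "q \<in> h -` G" "q' \<in> h -` G" for n n' q q'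
    using le[of n q n' q'] le[of n' q' n q] that by (cases "n \<le> n'") auto
  define \<phi> where "\<phi> x = (SOME r. \<exists>n. \<exists>q\<in>h -` G. x = nsmul n p + h q \<and> r = real n)" for x
  have \<phi>: "\<phi> (nsmul n p + h q) = real n" if "q \<in> h -` G" for n q
    unfolding \<phi>_def by (rule some_equality) (use that uniq in blast)+
  have NE: "\<exists>n. \<exists>q\<in>h -` G. x = nsmul n p + h q" if "x \<in> N" for x
    using that by (auto simp: N_def)
  have \<phi>0: "\<phi> 0 = 0"
    using \<phi>[of 0 0] H0 by simp
  have add_eq: "(nsmul n p + h q) + (nsmul n' p + h q') = nsmul (n + n') p + h (q + q')" for n n' q q'
    by (simp add: nsmul_add_left H0 add_ac)
  have closed: "q + q' \<in> h -` G" if "q \<in> h -` G" "q' \<in> h -` G" for q q'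
    using H that unfolding submonoid_add_def by blast
  have N: "submonoid_add N"
    unfolding submonoid_add_def
  proof (intro conjI ballI)
    have "0 = nsmul 0 p + h 0" using H0 by simp
    then show "0 \<in> N" unfolding N_def using H0 by blast
    fix x y assume "x \<in> N" "y \<in> N"
    then obtain n q n' q' where "q \<in> h -` G" "q' \<in> h -` G" "x = nsmul n p + h q" "y = nsmul n' p + h q'"
      using NE by meson
    then show "x + y \<in> N"
      unfolding N_def using add_eq[of n q n' q'] closed by blast
  qed
  have add: "\<phi> (x + y) = \<phi> x + \<phi> y" if xy: "x \<in> N" "y \<in> N" for x y
  proof -
    obtain n q n' q' where *: "q \<in> h -` G" "q' \<in> h -` G" "x = nsmul n p + h q" "y = nsmul n' p + h q'"
      using NE xy by meson
    show ?thesis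
      unfolding *(3,4) add_eq using \<phi> closed *(1,2) by simp
  qed
  obtain S :: "'p set" where S: "finite S" "submonoid_add hull S = UNIV"
    using fine_monoid_generators[OF fine] .
  obtain \<psi> where \<psi>N: "\<And>x. x \<in> N \<Longrightarrow> \<psi> x = \<phi> x"
    and \<psi>add': "\<And>x y. x \<in> submonoid_add hull (S \<union> N) \<Longrightarrow> y \<in> submonoid_add hull (S \<union> N) \<Longrightarrow>
      \<psi> (x + y) = \<psi> x + \<psi> y"
    using extend_additive[of N \<phi> S] cancel N \<phi>0 add S(1) by metis
  have "submonoid_add hull (S \<union> N) = UNIV"
    using hull_mono[of S "S \<union> N" submonoid_add] S(2) by auto
  then have \<psi>add: "\<psi> (x + y) = \<psi> x + \<psi> y" for x y
    using \<psi>add' by simp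
  have \<psi>0: "\<psi> 0 = 0" using \<psi>add[of 0 0] by simp
  have \<psi>h: "\<psi> (h q) = 0" if "q \<in> h -` G" for q
  proof -
    have "nsmul 0 p + h q \<in> N" unfolding N_def using that by blast
    then show ?thesis using \<psi>N \<phi>[of q 0] that by fastforce
  qed
  have \<psi>p: "\<psi> p = 1"
  proof -
    have "nsmul 1 p + h 0 \<in> N" unfolding N_def using H0 by blast
    then show ?thesis using \<psi>N \<phi>[of 0 1] H0 by fastforce
  qed
  \<comment> \<open>Extension by zero is multiplicative because \<open>G\<close> is a face. The base
    is \<open>Suc k\<close> so that it is positive; \<open>k = 0\<close> gives the indicator
    function of \<open>G\<close>.\<close>
  define \<chi> where "\<chi> k x = (if x \<in> G then real (Suc k) powr \<psi> x else 0)" for k :: nat and x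
  have G_iff: "x + y \<in> G \<longleftrightarrow> x \<in> G \<and> y \<in> G" for x y
    using G by (rule face_add_iff)
  have \<chi>_add: "\<chi> k (x + y) = \<chi> k x * \<chi> k y" for k x y
    by (auto simp: \<chi>_def G_iff \<psi>add powr_add)
  have \<chi>_0: "\<chi> k 0 = 1" for k
    using Gsub by (simp add: \<chi>_def \<psi>0 submonoid_add_def)
  define K where "K k = {x. monoid_algebra_eval (\<chi> k) x = 0}" for k
  have K: "K k \<in> prime_spectrum" for k
    unfolding K_def using \<chi>_0 \<chi>_add by (rule monoid_algebra_eval_kernel_prime)
  \<comment> \<open>On the preimage of \<open>G\<close> the value is 1, since \<open>\<psi>\<close>
    vanishes on its image, and elsewhere it is 0, whatever \<open>k\<close> is.\<close>
  have "\<chi> k \<circ> h = \<chi> 0 \<circ> h" for k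
    using \<psi>h by (auto simp: \<chi>_def fun_eq_iff)
  then have fib: "monoid_algebra_map h -` K k = monoid_algebra_map h -` K 0" for k
    unfolding K_def vimage_def mem_Collect_eq monoid_algebra_eval_map by metis
  have "monoid_algebra_map h -` K 0 \<in> prime_spectrum"
    using comm_ring_map.vimage_prime[OF comm_ring_map_monoid_algebra_map[OF hom] K] .
  then have "finite {\<qq>\<in>prime_spectrum. monoid_algebra_map h -` \<qq> = monoid_algebra_map h -` K 0}"
    using qf unfolding quasi_finite_map_def quasi_finite_ring_map_def by blast
  moreover have "range K \<subseteq> {\<qq>\<in>prime_spectrum. monoid_algebra_map h -` \<qq> = monoid_algebra_map h -` K 0}"
    by (intro image_subsetI CollectI conjI K fib)
  ultimately have "finite (range K)" by (rule finite_subset[rotated])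
  moreover have "inj K"
  proof (rule injI)
    fix j k assume "K j = K k"
    \<comment> \<open>The basis element at \<open>p\<close> minus the integer \<open>Suc j\<close>;
      \<open>\<chi> i\<close> gives it the value \<open>i - j\<close>, so it separates the
      kernels.\<close>
    let ?x = "frag_of p - frag_cmul (int (Suc j)) (frag_of 0)"
    have cmul: "monoid_algebra_eval (\<chi> i) (frag_cmul c (frag_of 0)) = of_int c" for i c
      using monoid_algebra_eval_superset[of "{0}" "frag_cmul c (frag_of 0)" "\<chi> i"]
        keys_cmul[of c "frag_of 0"] \<chi>_0 by simp
    have "\<chi> i p = real (Suc i)" for i
      using p \<psi>p by (simp add: \<chi>_def)
    then have "monoid_algebra_eval (\<chi> i) ?x = real (Suc i) - real (Suc j)" for i
      unfolding monoid_algebra_eval_diff cmul by simp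
    then have iff: "?x \<in> K i \<longleftrightarrow> i = j" for i
      by (simp add: K_def)
    show "j = k" using iff[of j] iff[of k] \<open>K j = K k\<close> by simp
  qed
  ultimately show False
    using finite_imageD infinite_UNIV_nat by blast
qed

section \<open>Local quasi-finite maps are dense\<close>

text \<open>A generator \<open>t \<notin> D\<close> satisfies \<open>k t = f + x\<close> with \<open>x \<in> G\<close>.  Expanding a multiple of \<open>x\<close> in the
  generators, the coefficient of \<open>t\<close> on the right stays below that on the left because \<open>f\<close> is not
  a unit, so the equation can be solved for \<open>t\<close> and \<open>t\<close> can be eliminated.\<close>

lemma face_generator_elimination:
  fixes D G :: "'a::comm_monoid_add set"
  assumes cancel: "\<And>a b c :: 'a. a + c = b + c \<Longrightarrow> a = b"
    and D: "submonoid_add D" and sat: "\<And>n x. n > 0 \<Longrightarrow> nsmul n x \<in> D \<Longrightarrow> x \<in> D"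
    and G: "face G" and f: "f \<in> D" "f \<in> G" "f \<notin> units_add"
    and gen: "\<And>t. t \<in> G \<Longrightarrow> t \<notin> D \<Longrightarrow> face_of t = G"
    and "finite T" "T \<subseteq> G"
    and "\<And>x. x \<in> G \<Longrightarrow> \<exists>n>0. nsmul n x \<in> submonoid_add hull (T \<union> D)"
  shows "G \<subseteq> D"
  using assms(9-)
proof (induction T rule: finite_induct)
  case empty
  have "submonoid_add hull D = D" using D by (rule hull_same)
  with empty show ?case using sat by auto
next
  case (insert t T)
  let ?M = "submonoid_add hull (T \<union> D)"
  have M: "submonoid_add ?M" by (rule submonoid_hull)
  have tG: "t \<in> G" using insert.prems by auto
  have "\<exists>c>0. nsmul c t \<in> ?M"
  proof (cases "t \<in> D")
    case True
    then show ?thesis by (intro exI[of _ 1]) (auto intro: hull_inc)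
  next
    case False
    then have "f \<in> face_of t" using gen tG f by blast
    then obtain k x where k: "nsmul k t = f + x" by (auto simp: face_of_def)
    then have "x \<in> G"
      using submonoid_nsmul[OF face_submonoid[OF G], of t k] tG face_add_iff[OF G] by simp
    then obtain n where n: "n > 0" "nsmul n x \<in> submonoid_add hull (insert t (T \<union> D))"
      using insert.prems by auto
    obtain y a where y: "y \<in> ?M" "nsmul n x = y + nsmul a t"
      using submonoid_hull_insertE[OF n(2)] .
    have eq: "nsmul (n * k) t = nsmul n f + y + nsmul a t"
      using k y by (simp add: nsmul_add_right add.assoc flip: nsmul_nsmul)
    show ?thesis
    proof (cases "a < n * k")
      case True
      then have "nsmul (n * k) t = nsmul (n * k - a) t + nsmul a t"
        by (simp flip: nsmul_add_left)
      then have "nsmul (n * k - a) t = nsmul n f + y"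
        using eq cancel by metis
      moreover have "nsmul n f \<in> ?M"
        using f(1) by (intro submonoid_nsmul[OF M] hull_inc) auto
      ultimately show ?thesis
        using True M y(1) by (intro exI[of _ "n * k - a"]) (auto simp: submonoid_add_def)
    next
      case False
      then have "nsmul a t = nsmul (a - n * k) t + nsmul (n * k) t"
        by (simp flip: nsmul_add_left)
      then have "0 + nsmul (n * k) t = (nsmul n f + y + nsmul (a - n * k) t) + nsmul (n * k) t"
        using eq by (simp add: add.assoc)
      then have "nsmul n f + (y + nsmul (a - n * k) t) = 0"
        using cancel by (metis add.assoc)
      then have "nsmul n f \<in> units_add" by (auto simp: units_add_def)
      then have "f \<in> units_add" using face_nsmul_iff[OF face_units_add n(1)] by blast
      then show ?thesis using f by blast
    qed
  qed
  then obtain c where c: "c > 0" "nsmul c t \<in> ?M" by blast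
  have "\<exists>n>0. nsmul n x \<in> ?M" if "x \<in> G" for x
  proof -
    obtain n where n: "n > 0" "nsmul n x \<in> submonoid_add hull (insert t (T \<union> D))"
      using insert.prems \<open>x \<in> G\<close> by auto
    obtain y a where y: "y \<in> ?M" "nsmul n x = y + nsmul a t"
      using submonoid_hull_insertE[OF n(2)] .
    \<comment> \<open>Multiplication by \<open>c\<close> turns every occurrence of \<open>t\<close>
      into \<open>nsmul c t\<close>, which lies in the smaller hull.\<close>
    have "nsmul (c * n) x = nsmul c y + nsmul a (nsmul c t)"
      using y(2) by (simp add: nsmul_add_right nsmul_nsmul mult.commute[of a] flip: nsmul_nsmul[of c n])
    also have "\<dots> \<in> ?M"
      using M submonoid_nsmul[OF M] y(1) c(2) by (simp add: submonoid_add_def)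
    finally show ?thesis using c n by (intro exI[of _ "c * n"]) auto
  qed
  then show ?case using insert.IH insert.prems by auto
qed

text \<open>Strong induction on the number of generators in a face \<open>G\<close> shows that
  \<open>G\<close> lies in the saturation \<open>D\<close> of the image; the face
  \<open>UNIV\<close> then gives density.\<close>

lemma quasi_finite_local_imp_dense:
  fixes h :: "'q::comm_monoid_add \<Rightarrow> 'p::comm_monoid_add"
  assumes hom: "monoid_map h" and fine: "fine_monoid TYPE('p)"
    and qf: "quasi_finite_map h" and loc: "local_map h"
  shows "dense_map h"
proof -
  define D where "D = {p. \<exists>n>0. nsmul n p \<in> range h}"
  have R: "submonoid_add (range h)" by (rule submonoid_range[OF hom])
  have D: "submonoid_add D"
    unfolding submonoid_add_def
  proof (intro conjI ballI)
    have "nsmul 1 0 \<in> range h" using R by (simp add: submonoid_add_def)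
    then show "0 \<in> D" unfolding D_def by (intro CollectI exI[of _ 1] conjI) auto
    fix x y assume "x \<in> D" "y \<in> D"
    then obtain m n where mn: "m > 0" "n > 0" "nsmul m x \<in> range h" "nsmul n y \<in> range h"
      by (auto simp only: D_def mem_Collect_eq)
    have "nsmul (m * n) (x + y) = nsmul n (nsmul m x) + nsmul m (nsmul n y)"
      by (simp add: nsmul_add_right nsmul_nsmul mult.commute)
    also have "\<dots> \<in> range h"
      by (intro submonoid_add[OF R] submonoid_nsmul[OF R] mn)
    finally have "nsmul (m * n) (x + y) \<in> range h" .
    moreover have "m * n > 0" using mn by simp
    ultimately show "x + y \<in> D"
      unfolding D_def by blast
  qed
  have sat: "x \<in> D" if "n > 0" "nsmul n x \<in> D" for n x
    using that unfolding D_def nsmul_nsmul mem_Collect_eq nsmul_nsmul by (metis nat_0_less_mult_iff)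
  obtain S :: "'p set" where S: "finite S" "submonoid_add hull S = UNIV"
    using fine_monoid_generators[OF fine] .
  have "G \<subseteq> D" if "face G" for G :: "'p set"
    using that
  proof (induction "card (S \<inter> G)" arbitrary: G rule: less_induct)
    case less
    note torsion = quasi_finite_face_torsion[OF hom fine qf less.prems]
    show ?case
    proof (cases "h -` G \<subseteq> units_add")
      \<comment> \<open>The denominator in the torsion equation comes from a unit of the source, so
        it can be moved to the other side inside the image.\<close>
      case True
      show ?thesis
      proof
        fix p assume "p \<in> G"
        then obtain n q q' where n: "n > 0" "q \<in> h -` G" "nsmul n p + h q = h q'"
          using torsion by blast
        obtain u where u: "q + u = 0" using True n by (auto simp: units_add_def)
        have h: "h 0 = 0" "\<And>x y. h (x + y) = h x + h y"
          using hom by (auto simp: monoid_map_def)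
        have "h q + h u = 0" using h u by metis
        then have "nsmul n p = h (q' + u)"
          unfolding h n(3)[symmetric] by (simp add: add.assoc)
        then show "p \<in> D" using n(1) by (auto simp: D_def)
      qed
    next
      case False
      then obtain q where q: "h q \<in> G" "q \<notin> units_add" by blast
      show ?thesis
      proof (rule face_generator_elimination[OF _ D sat less.prems])
        show "h q \<in> D" unfolding D_def by (auto intro!: exI[of _ 1])
        show "h q \<in> G" by fact
        \<comment> \<open>Locality carries non-units of the source to non-units of the
          target.\<close>
        show "h q \<notin> units_add" using loc q(2) by (auto simp: local_map_def)
        show "finite (S \<inter> G)" using S by simp
        \<comment> \<open>A smaller face inside \<open>G\<close> contains fewer generators, hence
          lies in \<open>D\<close> by induction, and so cannot contain \<open>t\<close>.\<close>
        show "face_of t = G" if t: "t \<in> G" "t \<notin> D" for t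
        proof (rule ccontr)
          assume neq: "face_of t \<noteq> G"
          have sub: "face_of t \<subseteq> G" using face_of_minimal[OF less.prems t(1)] .
          have "S \<inter> face_of t \<noteq> S \<inter> G"
            using neq face_hull_generators[OF face_face_of S(2)] face_hull_generators[OF less.prems S(2)] by metis
          then have "card (S \<inter> face_of t) < card (S \<inter> G)"
            using sub S(1) by (intro psubset_card_mono) auto
          then have "face_of t \<subseteq> D"
            using less.hyps face_face_of by blast
          then show False using t face_of_self by blast
        qed
        show "\<exists>n>0. nsmul n x \<in> submonoid_add hull (S \<inter> G \<union> D)" if "x \<in> G" for x
          using that face_hull_generators[OF less.prems S(2)]
            hull_mono[of "S \<inter> G" "S \<inter> G \<union> D" submonoid_add] by (intro exI[of _ 1]) auto
      qed (use fine_monoid_cancel[OF fine] in auto)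
    qed
  qed
  from this[of UNIV] show ?thesis
    unfolding dense_map_iff D_def by (auto simp: face_def submonoid_add_def)
qed

theorem theorem4p8p11:
  fixes h :: "'q::comm_monoid_add \<Rightarrow> 'p::comm_monoid_add"
  assumes "fine_monoid TYPE('q)" and "fine_monoid TYPE('p)"
    and "monoid_map h" and "inj h"
  shows "(dense_map h \<longleftrightarrow> finite_map h)
    \<and> (finite_map h \<longleftrightarrow> finite_map h \<and> homeomorphic_map Spec Spec (Spec_map h))
    \<and> (finite_map h \<and> homeomorphic_map Spec Spec (Spec_map h)
         \<longleftrightarrow> quasi_finite_map h \<and> Spec_map h ` topspace Spec = topspace Spec)
    \<and> (quasi_finite_map h \<and> Spec_map h ` topspace Spec = topspace Spec
         \<longleftrightarrow> quasi_finite_map h \<and> local_map h)"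
  \<comment> \<open>The cycle runs from dense to finite and homeomorphic, to quasi-finite and
    surjective on spectra, to quasi-finite and local, and back to dense; finite maps join it through
    \<open>finite_imp_dense\<close>.\<close>
  using finite_imp_dense[OF assms(3,2)] dense_imp_finite[OF assms(3,2)]
    dense_imp_homeomorphic[OF assms(3) _ assms(4)] finite_imp_quasi_finite[OF assms(3)]
    homeomorphic_imp_surjective_map[of Spec Spec "Spec_map h"]
    Spec_surjective_imp_local[OF assms(3)] quasi_finite_local_imp_dense[OF assms(3,2)]
  by blast

end
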